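(* Let $X$ be a set, $\tau$ a topology on $X$, $\mathcal{L}$ a bounded sublattice of $\wp(X)$, and $\mathcal{L}'$ a sublattice of $\mathcal{L}$. The following are equivalent: (1) $X$ has the $(\tau,\mathcal{L}')$ preservation property, i.e. $\tau\cap\mathcal{L}=\mathcal{L}'$, and $\mathcal{L}'$ defines only compact sets for the topology $\langle\mathcal{L}'\rangle$, i.e. every element of $\mathcal{L}'$ is compact for $\langle\mathcal{L}'\rangle$. (2) $\langle X,\tau,\mathcal{L}\rangle$ is a logically presented pre-spectral space and $\mathcal{L}'$ is a diagram base of it.
   Context: A sublattice of $\wp(X)$ is a collection of subsets of $X$ closed under binary unions and intersections; it is bounded if it contains $\emptyset$ and $X$. For a collection $\mathcal{O}$ of subsets of $X$, $\langle\mathcal{O}\rangle$ is the smallest topology on $X$ containing $\mathcal{O}$ (the topology with subbase $\mathcal{O}$). "Compact" means every open cover has a finite subcover (no separation axiom). Given a topology $\tau$ on $X$ and a bounded sublattice $\mathcal{L}$ of $\wp(X)$, $\langle X,\tau,\mathcal{L}\rangle$ denotes the topological space $(X,\langle\tau\cap\mathcal{L}\rangle)$; it is called a logically presented pre-spectral space if every element of $\tau\cap\mathcal{L}$ is compact in the topology $\langle\tau\cap\mathcal{L}\rangle$. A collection $\mathcal{L}'\subseteq\mathcal{L}$ is a diagram base of $\langle X,\tau,\mathcal{L}\rangle$ if $\langle\tau\cap\mathcal{L}\rangle=\langle\mathcal{L}'\rangle$.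
   Formalization: The sublattice L' of L is required to contain ∅ and X; without this (2) ⇒ (1) fails, e.g. X={x}, τ=L={∅,X}, L'={∅}, and (1) itself forces ∅ and X to lie in L'. *)

theory Defs
  imports "HOL-Analysis.Abstract_Topology"
begin

definition sublattice_Pow :: "'a set \<Rightarrow> 'a set set \<Rightarrow> bool" where
  "sublattice_Pow X L \<longleftrightarrow>
     L \<subseteq> Pow X \<and> (\<forall>A\<in>L. \<forall>B\<in>L. A \<union> B \<in> L \<and> A \<inter> B \<in> L)"

definition bounded_sublattice_Pow :: "'a set \<Rightarrow> 'a set set \<Rightarrow> bool" where
  "bounded_sublattice_Pow X L \<longleftrightarrow> sublattice_Pow X L \<and> {} \<in> L \<and> X \<in> L"

text \<open>
  Sublattices of a bounded lattice are taken in the sense of bounded lattices, i.e. they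
  share its bounds \<open>{}\<close> and \<open>X\<close>. The bounds matter: \<open>{}\<close>, \<open>{{}}\<close>, \<open>{X}\<close> and \<open>{{}, X}\<close>
  are all subbases of the indiscrete topology on \<open>X\<close>.
\<close>

definition sublattice_of :: "'a set \<Rightarrow> 'a set set \<Rightarrow> 'a set set \<Rightarrow> bool" where
  "sublattice_of X L' L \<longleftrightarrow> bounded_sublattice_Pow X L' \<and> L' \<subseteq> L"

text \<open>
  The topology on \<open>X\<close> with subbase \<open>\<O>\<close>. The relativisation to \<open>X\<close> makes the empty
  intersection equal to \<open>X\<close>, so that the carrier is \<open>X\<close> even when \<open>\<O>\<close> does not cover \<open>X\<close>
  (the carrier of \<open>topology_generated_by \<O>\<close> would be \<open>\<Union>\<O>\<close>). The three lemmas below say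
  that, for \<open>\<O> \<subseteq> Pow X\<close>, it is the smallest topology on \<open>X\<close> containing \<open>\<O>\<close>.
\<close>

definition generated_topology :: "'a set \<Rightarrow> 'a set set \<Rightarrow> 'a topology" where
  "generated_topology X \<O> =
     topology (arbitrary union_of (finite intersection_of (\<lambda>U. U \<in> \<O>) relative_to X))"

lemma topspace_generated_topology [simp]: "topspace (generated_topology X \<O>) = X"
  by (simp add: generated_topology_def)

lemma openin_generated_topology_subbase:
  assumes "\<O> \<subseteq> Pow X" "U \<in> \<O>"
  shows "openin (generated_topology X \<O>) U"
  using assms
  by (auto simp: generated_topology_def openin_subbase
      intro!: arbitrary_union_of_inc relative_to_subset_inc finite_intersection_of_inc)

lemma generated_topology_minimal:
  assumes "topspace T = X" "\<And>U. U \<in> \<O> \<Longrightarrow> openin T U"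
    and "openin (generated_topology X \<O>) S"
  shows "openin T S"
  using assms minimal_topology_subbase[of "\<lambda>U. U \<in> \<O>" T X S]
  by (auto simp: generated_topology_def)

definition open_sets :: "'a topology \<Rightarrow> 'a set set" where
  "open_sets \<tau> = {U. openin \<tau> U}"

definition logically_presented_space :: "'a set \<Rightarrow> 'a topology \<Rightarrow> 'a set set \<Rightarrow> 'a topology" where
  "logically_presented_space X \<tau> L = generated_topology X (open_sets \<tau> \<inter> L)"

definition logically_presented_pre_spectral :: "'a set \<Rightarrow> 'a topology \<Rightarrow> 'a set set \<Rightarrow> bool" where
  "logically_presented_pre_spectral X \<tau> L \<longleftrightarrow>
     (\<forall>U \<in> open_sets \<tau> \<inter> L. compactin (logically_presented_space X \<tau> L) U)"

definition diagram_base :: "'a set \<Rightarrow> 'a topology \<Rightarrow> 'a set set \<Rightarrow> 'a set set \<Rightarrow> bool" where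
  "diagram_base X \<tau> L L' \<longleftrightarrow>
     L' \<subseteq> L \<and> logically_presented_space X \<tau> L = generated_topology X L'"

definition preservation_property :: "'a topology \<Rightarrow> 'a set set \<Rightarrow> 'a set set \<Rightarrow> bool" where
  "preservation_property \<tau> L L' \<longleftrightarrow> open_sets \<tau> \<inter> L = L'"

definition defines_only_compact_sets :: "'a set \<Rightarrow> 'a set set \<Rightarrow> bool" where
  "defines_only_compact_sets X L' \<longleftrightarrow> (\<forall>U \<in> L'. compactin (generated_topology X L') U)"

end

theory Submission
  imports Defs
begin

text \<open>
  A bounded sublattice is closed under finite intersections, hence it is a base (not just a
  subbase) of the topology that it generates. A compact open set is then a finite union of
  members of the sublattice, hence a member itself.
\<close>

lemma bounded_sublattice_Pow_Union:
  assumes "bounded_sublattice_Pow X L" "finite \<F>" "\<F> \<subseteq> L"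
  shows "\<Union>\<F> \<in> L"
  using assms(2,3,1)
  by (induction rule: finite_induct)
    (simp_all add: bounded_sublattice_Pow_def sublattice_Pow_def)

text \<open>The factor \<open>X\<close> matches the relativised intersections in
  \<open>generated_topology\<close>. For the empty family \<open>\<Inter>\<F>\<close> is
  \<open>UNIV\<close>, so the value is \<open>X\<close>, which lies in \<open>L\<close> as its upper
  bound.\<close>

lemma bounded_sublattice_Pow_Inter:
  assumes "bounded_sublattice_Pow X L" "finite \<F>" "\<F> \<subseteq> L"
  shows "X \<inter> \<Inter>\<F> \<in> L"
  using assms(2,3,1)
proof (induction rule: finite_induct)
  case (insert A \<F>)
  have "X \<inter> \<Inter>(insert A \<F>) = A \<inter> (X \<inter> \<Inter>\<F>)"
    by auto
  with insert show ?case
    by (simp add: bounded_sublattice_Pow_def sublattice_Pow_def)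
qed (simp add: bounded_sublattice_Pow_def)

lemma openin_generated_topology_bounded_sublattice:
  assumes "bounded_sublattice_Pow X L" "openin (generated_topology X L) S"
  obtains \<U> where "\<U> \<subseteq> L" "\<Union>\<U> = S"
proof -
  \<comment> \<open>Passing from the subbase \<open>L\<close> to the base of its finite
    intersections adds nothing new, so arbitrary unions of basic sets are already unions of members
    of \<open>L\<close>.\<close>
  have base: "U \<in> L" if U: "(finite intersection_of (\<lambda>U. U \<in> L) relative_to X) U" for U
  proof -
    obtain \<F> where "finite \<F>" "\<F> \<subseteq> L" "U = X \<inter> \<Inter>\<F>"
      using U unfolding relative_to_def intersection_of_def by blast
    then show ?thesis
      using bounded_sublattice_Pow_Inter[OF assms(1)] by simp
  qed
  let ?B = "finite intersection_of (\<lambda>U. U \<in> L) relative_to X"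
  have "(arbitrary union_of ?B) S"
    using assms(2) by (simp add: generated_topology_def openin_subbase)
  then have "\<exists>\<U>. \<U> \<subseteq> Collect ?B \<and> \<Union>\<U> = S"
    by (simp add: union_of_def arbitrary_def)
  then obtain \<U> where \<U>: "\<U> \<subseteq> Collect ?B" "\<Union>\<U> = S"
    by (elim exE conjE)
  show thesis
    using base \<U>(1) by (intro that[OF _ \<U>(2)] subsetI) (simp add: subset_iff)
qed

lemma compactin_openin_generated_topology_mem:
  assumes L: "bounded_sublattice_Pow X L"
    and "openin (generated_topology X L) S" "compactin (generated_topology X L) S"
  shows "S \<in> L"
proof -
  obtain \<U> where \<U>: "\<U> \<subseteq> L" "\<Union>\<U> = S"
    using openin_generated_topology_bounded_sublattice[OF assms(1,2)] .
  have "L \<subseteq> Pow X"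
    using L by (simp add: bounded_sublattice_Pow_def sublattice_Pow_def)
  then have "\<forall>U\<in>\<U>. openin (generated_topology X L) U"
    using \<U>(1) openin_generated_topology_subbase by blast
  then obtain \<F> where "finite \<F>" "\<F> \<subseteq> \<U>" "S \<subseteq> \<Union>\<F>"
    using compactinD[OF assms(3), of \<U>] \<U>(2) by auto
  \<comment> \<open>The cover \<open>\<U>\<close> has union exactly \<open>S\<close>, so its members
    lie inside \<open>S\<close> and a finite subcover cannot overshoot.\<close>
  moreover from this have "\<Union>\<F> = S"
    using \<U>(2) by auto
  ultimately show ?thesis
    using bounded_sublattice_Pow_Union[OF L, of \<F>] \<U>(1) by auto
qed

theorem theorem3p4:
  fixes X :: "'a set" and \<tau> :: "'a topology" and L L' :: "'a set set"
  assumes "topspace \<tau> = X"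
    and "bounded_sublattice_Pow X L"
    and "sublattice_of X L' L"
  shows "preservation_property \<tau> L L' \<and> defines_only_compact_sets X L'
     \<longleftrightarrow> logically_presented_pre_spectral X \<tau> L \<and> diagram_base X \<tau> L L'"
proof
  assume "preservation_property \<tau> L L' \<and> defines_only_compact_sets X L'"
  then have "open_sets \<tau> \<inter> L = L'" "\<forall>U\<in>L'. compactin (generated_topology X L') U"
    unfolding preservation_property_def defines_only_compact_sets_def by blast+
  moreover have "L' \<subseteq> L"
    using assms(3) by (simp add: sublattice_of_def)
  \<comment> \<open>Substituting \<open>L'\<close> for \<open>open_sets \<tau> \<inter> L\<close>
    makes the two generated topologies literally the same term, and the compactness conditions
    coincide.\<close>
  ultimately show "logically_presented_pre_spectral X \<tau> L \<and> diagram_base X \<tau> L L'"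
    unfolding diagram_base_def logically_presented_pre_spectral_def logically_presented_space_def
    by simp
next
  assume "logically_presented_pre_spectral X \<tau> L \<and> diagram_base X \<tau> L L'"
  \<comment> \<open>The diagram base equation carries compactness over to the topology generated by
    \<open>L'\<close>, where the lemma on compact open sets applies.\<close>
  then have eq: "generated_topology X (open_sets \<tau> \<inter> L) = generated_topology X L'"
    and compact: "\<And>U. U \<in> open_sets \<tau> \<inter> L \<Longrightarrow> compactin (generated_topology X L') U"
    unfolding diagram_base_def logically_presented_pre_spectral_def logically_presented_space_def
    by auto
  have L': "bounded_sublattice_Pow X L'" "L' \<subseteq> L" "L' \<subseteq> Pow X"
    using assms(3)
    by (simp_all add: sublattice_of_def bounded_sublattice_Pow_def sublattice_Pow_def)
  have "open_sets \<tau> \<inter> L = L'"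
  proof
    \<comment> \<open>A member of the subbase \<open>open_sets \<tau> \<inter> L\<close> is open in
      the common topology and compact there, hence belongs to the lattice \<open>L'\<close>.\<close>
    show "open_sets \<tau> \<inter> L \<subseteq> L'"
    proof
      fix U assume U: "U \<in> open_sets \<tau> \<inter> L"
      have "open_sets \<tau> \<inter> L \<subseteq> Pow X"
        using assms(1) openin_subset unfolding open_sets_def by blast
      then have "openin (generated_topology X L') U"
        using openin_generated_topology_subbase[OF _ U] by (simp flip: eq)
      then show "U \<in> L'"
        using compactin_openin_generated_topology_mem[OF L'(1)] compact[OF U] by blast
    qed
    \<comment> \<open>Members of \<open>L'\<close> are open in the common topology, which is coarser
      than \<open>\<tau>\<close> because it is generated by sets open in
      \<open>\<tau>\<close>.\<close>
    show "L' \<subseteq> open_sets \<tau> \<inter> L"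
    proof
      fix U assume U: "U \<in> L'"
      then have "openin (generated_topology X (open_sets \<tau> \<inter> L)) U"
        using openin_generated_topology_subbase[OF L'(3)] by (simp add: eq)
      then have "openin \<tau> U"
        by (rule generated_topology_minimal[OF assms(1), rotated]) (simp add: open_sets_def)
      then show "U \<in> open_sets \<tau> \<inter> L"
        using U L'(2) by (auto simp: open_sets_def)
    qed
  qed
  then show "preservation_property \<tau> L L' \<and> defines_only_compact_sets X L'"
    using compact unfolding preservation_property_def defines_only_compact_sets_def by blast
qed

end
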